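(* Let $R$ be a commutative ring with identity and $S$ a multiplicative subset of $R$. Let $M$ be an $S$-finite $R$-module. Then $M$ is $S$-Noetherian if and only if for every prime ideal $\mathfrak{p}$ of $R$ with $\mathrm{Ann}(M)\subseteq \mathfrak{p}$, there exists an $S$-finite submodule $N^{\mathfrak{p}}$ of $M$ such that $\mathfrak{p}M\subseteq N^{\mathfrak{p}}\subseteq M(\mathfrak{p})$.
   Context: All rings are commutative with identity and all modules are unitary. A multiplicative subset $S$ of $R$ is a subset with $1\in S$ and $s_1s_2\in S$ for all $s_1,s_2\in S$. An $R$-module $M$ is called $S$-finite if there exist $s\in S$ and a finitely generated submodule $F$ of $M$ with $sM\subseteq F$. An $R$-module $M$ is called $S$-Noetherian if every submodule of $M$ is an $S$-finite $R$-module. $\mathrm{Ann}(M)=\{r\in R\mid rM=0\}$. For a prime ideal $\mathfrak{p}$ of $R$, $M(\mathfrak{p}):=\{x\in M\mid sx\in \mathfrak{p}M \text{ for some } s\in R\setminus \mathfrak{p}\}$, which is a submodule of $M$. *)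

theory Defs
  imports "HOL-Algebra.Module" "HOL-Algebra.Ideal"
begin

definition gen_submodule ::
    "('a, 'r) ring_scheme \<Rightarrow> ('a, 'b, 'm) module_scheme \<Rightarrow> 'b set \<Rightarrow> 'b set"
  where "gen_submodule R M A = \<Inter>{N. submodule N R M \<and> A \<subseteq> N}"

definition fg_submodule ::
    "('a, 'r) ring_scheme \<Rightarrow> ('a, 'b, 'm) module_scheme \<Rightarrow> 'b set \<Rightarrow> bool"
  where "fg_submodule R M F \<longleftrightarrow>
    submodule F R M \<and> (\<exists>A \<subseteq> carrier M. finite A \<and> F = gen_submodule R M A)"

definition S_finite ::
    "('a, 'r) ring_scheme \<Rightarrow> 'a set \<Rightarrow> ('a, 'b, 'm) module_scheme \<Rightarrow> bool"
  where "S_finite R S M \<longleftrightarrow>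
    (\<exists>s \<in> S. \<exists>F. fg_submodule R M F \<and> (\<forall>x \<in> carrier M. s \<odot>\<^bsub>M\<^esub> x \<in> F))"

text \<open>
  As in \<open>submodule.submodule_is_module\<close>, a submodule \<open>N\<close> of \<open>M\<close> is regarded as
  a module in its own right by restricting the carrier of \<open>M\<close> to \<open>N\<close>.
\<close>

definition S_noetherian ::
    "('a, 'r) ring_scheme \<Rightarrow> 'a set \<Rightarrow> ('a, 'b, 'm) module_scheme \<Rightarrow> bool"
  where "S_noetherian R S M \<longleftrightarrow>
    (\<forall>N. submodule N R M \<longrightarrow> S_finite R S (M\<lparr>carrier := N\<rparr>))"

definition Ann :: "('a, 'r) ring_scheme \<Rightarrow> ('a, 'b, 'm) module_scheme \<Rightarrow> 'a set"
  where "Ann R M = {r \<in> carrier R. \<forall>x \<in> carrier M. r \<odot>\<^bsub>M\<^esub> x = \<zero>\<^bsub>M\<^esub>}"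

text \<open>The product \<open>I M\<close> is the submodule generated by the products, not just their set.\<close>

definition ideal_smult ::
    "('a, 'r) ring_scheme \<Rightarrow> 'a set \<Rightarrow> ('a, 'b, 'm) module_scheme \<Rightarrow> 'b set"
  where "ideal_smult R I M = gen_submodule R M {a \<odot>\<^bsub>M\<^esub> x | a x. a \<in> I \<and> x \<in> carrier M}"

text \<open>The submodule \<open>M(\<pp>)\<close> attached to a prime ideal \<open>\<pp>\<close>.\<close>

definition prime_saturation ::
    "('a, 'r) ring_scheme \<Rightarrow> ('a, 'b, 'm) module_scheme \<Rightarrow> 'a set \<Rightarrow> 'b set"
  where "prime_saturation R M \<pp> =
    {x \<in> carrier M. \<exists>s \<in> carrier R - \<pp>. s \<odot>\<^bsub>M\<^esub> x \<in> ideal_smult R \<pp> M}"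

end

theory Submission
  imports Defs
begin

text \<open>
  The forward direction is immediate with \<open>\<pp>M\<close> itself as \<open>N\<close>: the element \<open>\<one>\<close> lies outside \<open>\<pp>\<close>,
  so \<open>\<pp>M \<subseteq> M(\<pp>)\<close>.

  The converse is a Cohen-type argument.  If \<open>M\<close> is not \<open>S\<close>-Noetherian, Zorn's lemma yields a
  submodule \<open>N\<close> that is maximal among the submodules that are not \<open>S\<close>-finite
  (\<open>exists_maximal_not_S_fin\<close>).  Everything rests on one principle, \<open>S_fin_of_sum_and_inter\<close>: if
  \<open>N + K\<close> is \<open>S\<close>-finite and some \<open>S\<close>-finite \<open>P\<close> satisfies \<open>N \<inter> K \<subseteq> P \<subseteq> N\<close>, then \<open>N\<close> is \<open>S\<close>-finite.

  Taking \<open>K = aM\<close> and \<open>P = N \<inter> aM = a(N : a)\<close>, where \<open>(N : a) = {x \<in> M. ax \<in> N}\<close>, this shows that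
  \<open>N + aM\<close> and \<open>(N : a)\<close> cannot both be strictly larger than \<open>N\<close>: every ring element \<open>a\<close> satisfies
  \<open>aM \<subseteq> N\<close> or \<open>(N : a) = N\<close> (\<open>smult_into_or_cancel\<close>).  So the ideal \<open>\<pp> = (N : M)\<close> of the \<open>a\<close> of
  the first kind is prime, and every element outside \<open>\<pp>\<close> acts injectively on \<open>M/N\<close>.  Two
  consequences follow: \<open>M(\<pp>) \<subseteq> N\<close>, and \<open>rx \<in> N\<close> forces \<open>r \<in> \<pp>\<close> for each \<open>x \<in> M - N\<close>.
  Since \<open>M\<close> is \<open>S\<close>-finite while \<open>N\<close> is not, such an \<open>x\<close> exists.  The hypothesis for \<open>\<pp>\<close> supplies an
  \<open>S\<close>-finite \<open>P\<close> with \<open>\<pp>M \<subseteq> P \<subseteq> M(\<pp>) \<subseteq> N\<close>, and \<open>N \<inter> Rx \<subseteq> \<pp>x \<subseteq> P\<close>.  By the same principle, now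
  with \<open>K = Rx\<close>, the module \<open>N\<close> would be \<open>S\<close>-finite, a contradiction.
\<close>


section \<open>Submodules and generated submodules\<close>

context module
begin

text \<open>
  Closure under negation comes for free from multiplication by \<open>\<ominus>\<one>\<close>.  Leaving it out makes the
  criterion insensitive to the carrier in which additive inverses are taken.
\<close>

lemma submodule_iff:
  "submodule H R M \<longleftrightarrow> H \<subseteq> carrier M \<and> \<zero>\<^bsub>M\<^esub> \<in> H \<and>
     (\<forall>x\<in>H. \<forall>y\<in>H. x \<oplus>\<^bsub>M\<^esub> y \<in> H) \<and> (\<forall>a\<in>carrier R. \<forall>x\<in>H. a \<odot>\<^bsub>M\<^esub> x \<in> H)"
    (is "?L \<longleftrightarrow> ?R")
proof
  assume L: ?L
  have "\<zero>\<^bsub>M\<^esub> \<in> H"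
    using subgroup.one_closed[OF submodule.axioms(1)[OF L]] by simp
  then show ?R
    using submoduleE[OF L] by blast
next
  assume R: ?R
  show ?L
  proof (rule submoduleI)
    fix x assume x: "x \<in> H"
    have "\<ominus>\<^bsub>M\<^esub> x = (\<ominus> \<one>) \<odot>\<^bsub>M\<^esub> x"
      using R x smult_l_minus[of \<one> x] by auto
    then show "\<ominus>\<^bsub>M\<^esub> x \<in> H"
      using R x by auto
  qed (use R in auto)
qed

lemma
  assumes "submodule H R M"
  shows submodule_subset: "H \<subseteq> carrier M"
    and submodule_zero: "\<zero>\<^bsub>M\<^esub> \<in> H"
    and submodule_add: "\<lbrakk>x \<in> H; y \<in> H\<rbrakk> \<Longrightarrow> x \<oplus>\<^bsub>M\<^esub> y \<in> H"
    and submodule_smult: "\<lbrakk>a \<in> carrier R; x \<in> H\<rbrakk> \<Longrightarrow> a \<odot>\<^bsub>M\<^esub> x \<in> H"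
  using assms unfolding submodule_iff by blast+

lemma submodule_add_cancel:
  assumes "submodule H R M" "x \<in> H" "x \<oplus>\<^bsub>M\<^esub> y \<in> H" "y \<in> carrier M"
  shows "y \<in> H"
proof -
  have x: "x \<in> carrier M"
    using assms submodule_subset by blast
  have "\<ominus>\<^bsub>M\<^esub> x \<oplus>\<^bsub>M\<^esub> (x \<oplus>\<^bsub>M\<^esub> y) = y"
    using x assms(4) by (simp add: M.r_neg1)
  then show ?thesis
    using assms submodule_add submoduleE(3) by metis
qed

lemma submodule_restrict_iff:
  assumes N: "submodule N R M"
  shows "submodule H R (M\<lparr>carrier := N\<rparr>) \<longleftrightarrow> submodule H R M \<and> H \<subseteq> N"
proof -
  interpret N: module R "M\<lparr>carrier := N\<rparr>"
    using submodule.submodule_is_module[OF N module_axioms] .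
  show ?thesis
    unfolding submodule_iff N.submodule_iff using submodule_subset[OF N] by auto
qed

lemma submodule_gen_submodule:
  assumes "A \<subseteq> carrier M"
  shows "submodule (gen_submodule R M A) R M"
  using carrier_is_submodule assms
  unfolding submodule_iff gen_submodule_def by auto

lemma gen_submodule_incl: "A \<subseteq> gen_submodule R M A"
  unfolding gen_submodule_def by blast

lemma gen_submodule_least:
  "\<lbrakk>submodule N R M; A \<subseteq> N\<rbrakk> \<Longrightarrow> gen_submodule R M A \<subseteq> N"
  unfolding gen_submodule_def by blast

lemma gen_submodule_mono: "A \<subseteq> B \<Longrightarrow> gen_submodule R M A \<subseteq> gen_submodule R M B"
  unfolding gen_submodule_def by blast

lemma gen_submodule_restrict:
  assumes N: "submodule N R M" and A: "A \<subseteq> N"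
  shows "gen_submodule R (M\<lparr>carrier := N\<rparr>) A = gen_submodule R M A"
proof
  have gM: "submodule (gen_submodule R M A) R M"
    using submodule_gen_submodule A submodule_subset[OF N] by blast
  then show "gen_submodule R (M\<lparr>carrier := N\<rparr>) A \<subseteq> gen_submodule R M A"
    unfolding gen_submodule_def[of R "M\<lparr>carrier := N\<rparr>"] submodule_restrict_iff[OF N]
    using gen_submodule_incl gen_submodule_least[OF N A] by blast
  show "gen_submodule R M A \<subseteq> gen_submodule R (M\<lparr>carrier := N\<rparr>) A"
    unfolding gen_submodule_def submodule_restrict_iff[OF N] by blast
qed

lemma submodule_residual:
  assumes N: "submodule N R M" and a: "a \<in> carrier R"
  shows "submodule {x \<in> carrier M. a \<odot>\<^bsub>M\<^esub> x \<in> N} R M"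
proof -
  have "a \<odot>\<^bsub>M\<^esub> (b \<odot>\<^bsub>M\<^esub> x) = b \<odot>\<^bsub>M\<^esub> (a \<odot>\<^bsub>M\<^esub> x)"
    if "b \<in> carrier R" "x \<in> carrier M" for b x
    using that a by (metis R.m_comm smult_assoc1)
  then show ?thesis
    unfolding submodule_iff
    using a submodule_zero[OF N] submodule_add[OF N] submodule_smult[OF N]
    by (auto simp: smult_r_distr)
qed

lemma submodule_smult_image:
  assumes L: "submodule L R M" and a: "a \<in> carrier R"
  shows "submodule ((\<lambda>x. a \<odot>\<^bsub>M\<^esub> x) ` L) R M"
  unfolding submodule_iff
proof (intro conjI ballI)
  show "(\<lambda>x. a \<odot>\<^bsub>M\<^esub> x) ` L \<subseteq> carrier M"
    using a submodule_subset[OF L] by auto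
  show "\<zero>\<^bsub>M\<^esub> \<in> (\<lambda>x. a \<odot>\<^bsub>M\<^esub> x) ` L"
    using a submodule_zero[OF L] smult_r_null by (metis imageI)
next
  fix x y assume "x \<in> (\<lambda>x. a \<odot>\<^bsub>M\<^esub> x) ` L" "y \<in> (\<lambda>x. a \<odot>\<^bsub>M\<^esub> x) ` L"
  then obtain u v where uv: "u \<in> L" "v \<in> L" "x = a \<odot>\<^bsub>M\<^esub> u" "y = a \<odot>\<^bsub>M\<^esub> v"
    by blast
  then have "x \<oplus>\<^bsub>M\<^esub> y = a \<odot>\<^bsub>M\<^esub> (u \<oplus>\<^bsub>M\<^esub> v)"
    using a submodule_subset[OF L] smult_r_distr[of a u v] by (simp add: subset_iff)
  then show "x \<oplus>\<^bsub>M\<^esub> y \<in> (\<lambda>x. a \<odot>\<^bsub>M\<^esub> x) ` L"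
    using uv submodule_add[OF L] by blast
next
  fix b x assume b: "b \<in> carrier R" and "x \<in> (\<lambda>x. a \<odot>\<^bsub>M\<^esub> x) ` L"
  then obtain u where u: "u \<in> L" "x = a \<odot>\<^bsub>M\<^esub> u"
    by blast
  then have "b \<odot>\<^bsub>M\<^esub> x = a \<odot>\<^bsub>M\<^esub> (b \<odot>\<^bsub>M\<^esub> u)"
    using a b submodule_subset[OF L] by (metis R.m_comm smult_assoc1 subsetD)
  then show "b \<odot>\<^bsub>M\<^esub> x \<in> (\<lambda>x. a \<odot>\<^bsub>M\<^esub> x) ` L"
    using u b submodule_smult[OF L] by blast
qed

lemma submodule_cyclic:
  assumes x: "x \<in> carrier M"
  shows "submodule ((\<lambda>r. r \<odot>\<^bsub>M\<^esub> x) ` carrier R) R M"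
  unfolding submodule_iff
proof (intro conjI ballI)
  show "(\<lambda>r. r \<odot>\<^bsub>M\<^esub> x) ` carrier R \<subseteq> carrier M"
    using x by auto
  show "\<zero>\<^bsub>M\<^esub> \<in> (\<lambda>r. r \<odot>\<^bsub>M\<^esub> x) ` carrier R"
    using x smult_l_null by (metis imageI R.zero_closed)
next
  fix u v assume "u \<in> (\<lambda>r. r \<odot>\<^bsub>M\<^esub> x) ` carrier R" "v \<in> (\<lambda>r. r \<odot>\<^bsub>M\<^esub> x) ` carrier R"
  then obtain a b where "a \<in> carrier R" "b \<in> carrier R" "u = a \<odot>\<^bsub>M\<^esub> x" "v = b \<odot>\<^bsub>M\<^esub> x"
    by blast
  then show "u \<oplus>\<^bsub>M\<^esub> v \<in> (\<lambda>r. r \<odot>\<^bsub>M\<^esub> x) ` carrier R"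
    using x smult_l_distr by (metis imageI R.add.m_closed)
next
  fix b u assume b: "b \<in> carrier R" and "u \<in> (\<lambda>r. r \<odot>\<^bsub>M\<^esub> x) ` carrier R"
  then obtain a where a: "a \<in> carrier R" "u = a \<odot>\<^bsub>M\<^esub> x"
    by blast
  then have "b \<odot>\<^bsub>M\<^esub> u = (b \<otimes> a) \<odot>\<^bsub>M\<^esub> x"
    using b x by (simp add: smult_assoc1)
  then show "b \<odot>\<^bsub>M\<^esub> u \<in> (\<lambda>r. r \<odot>\<^bsub>M\<^esub> x) ` carrier R"
    using a b by blast
qed

lemma set_add_memI: "\<lbrakk>x \<in> N; y \<in> K\<rbrakk> \<Longrightarrow> x \<oplus>\<^bsub>M\<^esub> y \<in> N <+>\<^bsub>M\<^esub> K"
  unfolding set_add_def' by blast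

lemma set_add_memE:
  assumes "z \<in> N <+>\<^bsub>M\<^esub> K"
  obtains x y where "x \<in> N" "y \<in> K" "z = x \<oplus>\<^bsub>M\<^esub> y"
  using assms unfolding set_add_def' by blast

lemma submodule_sum:
  assumes N: "submodule N R M" and K: "submodule K R M"
  shows "submodule (N <+>\<^bsub>M\<^esub> K) R M"
  unfolding submodule_iff
proof (intro conjI ballI)
  show "N <+>\<^bsub>M\<^esub> K \<subseteq> carrier M"
    using submodule_subset[OF N] submodule_subset[OF K] by (auto elim!: set_add_memE)
  show "\<zero>\<^bsub>M\<^esub> \<in> N <+>\<^bsub>M\<^esub> K"
    using set_add_memI[OF submodule_zero[OF N] submodule_zero[OF K]] by simp
next
  fix u v assume "u \<in> N <+>\<^bsub>M\<^esub> K" "v \<in> N <+>\<^bsub>M\<^esub> K"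
  then obtain x y x' y' where *: "x \<in> N" "y \<in> K" "x' \<in> N" "y' \<in> K"
    "u = x \<oplus>\<^bsub>M\<^esub> y" "v = x' \<oplus>\<^bsub>M\<^esub> y'"
    by (elim set_add_memE)
  then have "u \<oplus>\<^bsub>M\<^esub> v = (x \<oplus>\<^bsub>M\<^esub> x') \<oplus>\<^bsub>M\<^esub> (y \<oplus>\<^bsub>M\<^esub> y')"
    using submodule_subset[OF N] submodule_subset[OF K] by (simp add: subset_iff M.a_ac)
  then show "u \<oplus>\<^bsub>M\<^esub> v \<in> N <+>\<^bsub>M\<^esub> K"
    using * set_add_memI submodule_add[OF N] submodule_add[OF K] by metis
next
  fix a u assume a: "a \<in> carrier R" and "u \<in> N <+>\<^bsub>M\<^esub> K"
  then obtain x y where *: "x \<in> N" "y \<in> K" "u = x \<oplus>\<^bsub>M\<^esub> y"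
    by (elim set_add_memE)
  then have "a \<odot>\<^bsub>M\<^esub> u = a \<odot>\<^bsub>M\<^esub> x \<oplus>\<^bsub>M\<^esub> a \<odot>\<^bsub>M\<^esub> y"
    using a submodule_subset[OF N] submodule_subset[OF K] by (simp add: subset_iff smult_r_distr)
  then show "a \<odot>\<^bsub>M\<^esub> u \<in> N <+>\<^bsub>M\<^esub> K"
    using * a set_add_memI submodule_smult[OF N] submodule_smult[OF K] by metis
qed

lemma submodule_subset_sum:
  assumes N: "submodule N R M" and K: "submodule K R M"
  shows "N \<subseteq> N <+>\<^bsub>M\<^esub> K" "K \<subseteq> N <+>\<^bsub>M\<^esub> K"
proof
  fix x assume "x \<in> N"
  then show "x \<in> N <+>\<^bsub>M\<^esub> K"
    using set_add_memI[OF _ submodule_zero[OF K]] submodule_subset[OF N] by fastforce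
next
  show "K \<subseteq> N <+>\<^bsub>M\<^esub> K"
  proof
    fix x assume "x \<in> K"
    then show "x \<in> N <+>\<^bsub>M\<^esub> K"
      using set_add_memI[OF submodule_zero[OF N]] submodule_subset[OF K] by fastforce
  qed
qed

lemma submodule_Union_chain:
  assumes "\<C> \<noteq> {}" and chain: "subset.chain {N. submodule N R M} \<C>"
  shows "submodule (\<Union>\<C>) R M"
  unfolding submodule_iff
proof (intro conjI ballI)
  have sub: "\<And>N. N \<in> \<C> \<Longrightarrow> submodule N R M"
    and tot: "\<And>X Y. \<lbrakk>X \<in> \<C>; Y \<in> \<C>\<rbrakk> \<Longrightarrow> X \<subseteq> Y \<or> Y \<subseteq> X"
    using chain unfolding subset_chain_def by auto
  show "\<Union>\<C> \<subseteq> carrier M"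
    using sub submodule_subset by blast
  show "\<zero>\<^bsub>M\<^esub> \<in> \<Union>\<C>"
    using assms(1) sub submodule_zero by blast
  fix x assume "x \<in> \<Union>\<C>"
  then obtain X where X: "X \<in> \<C>" "x \<in> X" by blast
  show "a \<odot>\<^bsub>M\<^esub> x \<in> \<Union>\<C>" if "a \<in> carrier R" for a
    using X sub submodule_smult that by blast
  fix y assume "y \<in> \<Union>\<C>"
  then obtain Y where Y: "Y \<in> \<C>" "y \<in> Y" by blast
  obtain Z where "Z \<in> \<C>" "x \<in> Z" "y \<in> Z"
    using tot[OF X(1) Y(1)] X Y by blast
  then show "x \<oplus>\<^bsub>M\<^esub> y \<in> \<Union>\<C>"
    using sub submodule_add by blast
qed

lemma smult_mem_ideal_smult:
  "\<lbrakk>a \<in> I; x \<in> carrier M\<rbrakk> \<Longrightarrow> a \<odot>\<^bsub>M\<^esub> x \<in> ideal_smult R I M"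
  unfolding ideal_smult_def by (rule subsetD[OF gen_submodule_incl]) blast

lemma submodule_ideal_smult:
  "I \<subseteq> carrier R \<Longrightarrow> submodule (ideal_smult R I M) R M"
  unfolding ideal_smult_def by (rule submodule_gen_submodule) auto

lemma ideal_smult_subset_prime_saturation:
  assumes "primeideal \<pp> R"
  shows "ideal_smult R \<pp> M \<subseteq> prime_saturation R M \<pp>"
proof
  interpret P: primeideal \<pp> R by fact
  fix x assume x: "x \<in> ideal_smult R \<pp> M"
  then have xM: "x \<in> carrier M"
    using submodule_subset[OF submodule_ideal_smult[OF P.a_subset]] by blast
  moreover have "\<one> \<in> carrier R - \<pp>"
    using P.I_notcarr P.one_imp_carrier by auto
  ultimately show "x \<in> prime_saturation R M \<pp>"
    unfolding prime_saturation_def using x by (auto intro!: bexI[of _ \<one>])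
qed

end


section \<open>Submodules that are finite up to a multiplicative set\<close>

locale module_with_multset = module R M + S: submonoid S R
  for R (structure) and M (structure) and S
begin

text \<open>
  \<open>S\<close>-finiteness of a submodule expressed inside the ambient module, so that generated submodules
  of different submodules can be compared directly.
\<close>

definition S_fin :: "'c set \<Rightarrow> bool" where
  "S_fin N \<longleftrightarrow>
    (\<exists>s\<in>S. \<exists>A. finite A \<and> A \<subseteq> N \<and> (\<forall>x\<in>N. s \<odot>\<^bsub>M\<^esub> x \<in> gen_submodule R M A))"

lemma S_finI:
  "\<lbrakk>s \<in> S; finite A; A \<subseteq> N; \<And>x. x \<in> N \<Longrightarrow> s \<odot>\<^bsub>M\<^esub> x \<in> gen_submodule R M A\<rbrakk> \<Longrightarrow> S_fin N"
  unfolding S_fin_def by blast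

lemma S_finE:
  assumes "S_fin N"
  obtains s A where "s \<in> S" "finite A" "A \<subseteq> N"
    "\<And>x. x \<in> N \<Longrightarrow> s \<odot>\<^bsub>M\<^esub> x \<in> gen_submodule R M A"
  using assms unfolding S_fin_def by blast

lemma S_finite_restrict_iff:
  assumes N: "submodule N R M"
  shows "S_finite R S (M\<lparr>carrier := N\<rparr>) \<longleftrightarrow> S_fin N"
proof -
  interpret N: module R "M\<lparr>carrier := N\<rparr>"
    using submodule.submodule_is_module[OF N module_axioms] .
  have fg: "fg_submodule R (M\<lparr>carrier := N\<rparr>) F \<longleftrightarrow>
      (\<exists>A\<subseteq>N. finite A \<and> F = gen_submodule R M A)" for F
  proof -
    have "submodule (gen_submodule R M A) R (M\<lparr>carrier := N\<rparr>)" if "A \<subseteq> N" for A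
      using N.submodule_gen_submodule[of A] that gen_submodule_restrict[OF N that] by simp
    moreover have "A \<subseteq> N \<and> finite A \<and> F = gen_submodule R (M\<lparr>carrier := N\<rparr>) A \<longleftrightarrow>
        A \<subseteq> N \<and> finite A \<and> F = gen_submodule R M A" for A
      using gen_submodule_restrict[OF N, of A] by auto
    ultimately show ?thesis
      unfolding fg_submodule_def by auto
  qed
  show ?thesis
    unfolding S_finite_def S_fin_def fg by auto
qed

lemma S_finite_iff: "S_finite R S M \<longleftrightarrow> S_fin (carrier M)"
  using S_finite_restrict_iff[OF carrier_is_submodule] by simp

lemma S_noetherian_iff:
  "S_noetherian R S M \<longleftrightarrow> (\<forall>N. submodule N R M \<longrightarrow> S_fin N)"
  unfolding S_noetherian_def using S_finite_restrict_iff by blast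

lemma S_fin_smult_image:
  assumes L: "L \<subseteq> carrier M" and fin: "S_fin L" and a: "a \<in> carrier R"
  shows "S_fin ((\<lambda>x. a \<odot>\<^bsub>M\<^esub> x) ` L)"
proof -
  from fin obtain s B where s: "s \<in> S" and B: "finite B" "B \<subseteq> L"
    and sB: "\<And>x. x \<in> L \<Longrightarrow> s \<odot>\<^bsub>M\<^esub> x \<in> gen_submodule R M B"
    by (rule S_finE) blast
  let ?aB = "(\<lambda>x. a \<odot>\<^bsub>M\<^esub> x) ` B"
  have aB: "submodule (gen_submodule R M ?aB) R M"
    using B L a by (intro submodule_gen_submodule) auto
  have "gen_submodule R M B \<subseteq> {x \<in> carrier M. a \<odot>\<^bsub>M\<^esub> x \<in> gen_submodule R M ?aB}"
    using B L gen_submodule_incl[of ?aB]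
    by (intro gen_submodule_least submodule_residual aB a) auto
  moreover have "s \<odot>\<^bsub>M\<^esub> (a \<odot>\<^bsub>M\<^esub> x) = a \<odot>\<^bsub>M\<^esub> (s \<odot>\<^bsub>M\<^esub> x)" if "x \<in> L" for x
    using that s a L S.subset by (metis R.m_comm smult_assoc1 subsetD)
  ultimately have "s \<odot>\<^bsub>M\<^esub> (a \<odot>\<^bsub>M\<^esub> x) \<in> gen_submodule R M ?aB" if "x \<in> L" for x
    using that sB[OF that] by auto
  then show ?thesis
    using s B by (intro S_finI[of s ?aB]) auto
qed

text \<open>
  Generators of \<open>N + K\<close> split into a part in \<open>N\<close> and a part in \<open>K\<close>.  So a multiple \<open>sx\<close> of any
  \<open>x \<in> N\<close> is a combination of finitely many elements of \<open>N\<close> up to an error in \<open>K\<close>; the error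
  is a difference of elements of \<open>N\<close>, hence lies in \<open>N \<inter> K\<close>, and \<open>P\<close> absorbs it after a further
  multiplication by an element of \<open>S\<close>.
\<close>

lemma S_fin_of_sum_and_inter:
  assumes N: "submodule N R M" and K: "submodule K R M"
    and sum: "S_fin (N <+>\<^bsub>M\<^esub> K)"
    and P: "S_fin P" "N \<inter> K \<subseteq> P" "P \<subseteq> N"
  shows "S_fin N"
proof -
  from sum obtain s B where s: "s \<in> S" and B: "finite B" "B \<subseteq> N <+>\<^bsub>M\<^esub> K"
    and sB: "\<And>x. x \<in> N <+>\<^bsub>M\<^esub> K \<Longrightarrow> s \<odot>\<^bsub>M\<^esub> x \<in> gen_submodule R M B"
    by (rule S_finE) blast
  from P(1) obtain t Q where t: "t \<in> S" and Q: "finite Q" "Q \<subseteq> P"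
    and tQ: "\<And>x. x \<in> P \<Longrightarrow> t \<odot>\<^bsub>M\<^esub> x \<in> gen_submodule R M Q"
    by (rule S_finE) blast
  have "\<forall>b\<in>B. \<exists>n k. n \<in> N \<and> k \<in> K \<and> b = n \<oplus>\<^bsub>M\<^esub> k"
    using B(2) set_add_memE by (metis subsetD)
  then obtain n k where nk: "\<And>b. b \<in> B \<Longrightarrow> n b \<in> N \<and> k b \<in> K \<and> b = n b \<oplus>\<^bsub>M\<^esub> k b"
    by metis
  define A where "A = n ` B"
  have AN: "A \<subseteq> N" and finA: "finite A"
    using nk B(1) by (auto simp: A_def)
  have NM: "N \<subseteq> carrier M" and KM: "K \<subseteq> carrier M"
    using submodule_subset N K by auto
  have gA: "submodule (gen_submodule R M A) R M"
    using AN NM by (intro submodule_gen_submodule) auto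
  have gAQ: "submodule (gen_submodule R M (A \<union> Q)) R M"
    using AN NM Q P(3) by (intro submodule_gen_submodule) auto
  have "B \<subseteq> gen_submodule R M A <+>\<^bsub>M\<^esub> K"
  proof
    fix b assume b: "b \<in> B"
    then have "n b \<in> gen_submodule R M A"
      using gen_submodule_incl[of A] by (auto simp: A_def)
    then show "b \<in> gen_submodule R M A <+>\<^bsub>M\<^esub> K"
      using nk[OF b] set_add_memI by metis
  qed
  then have split: "gen_submodule R M B \<subseteq> gen_submodule R M A <+>\<^bsub>M\<^esub> K"
    by (intro gen_submodule_least submodule_sum gA K)
  have sR: "s \<in> carrier R" and tR: "t \<in> carrier R"
    using s t S.subset by auto
  show ?thesis
  proof (rule S_finI[of "t \<otimes> s" "A \<union> Q"])
    fix x assume x: "x \<in> N"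
    then have "s \<odot>\<^bsub>M\<^esub> x \<in> gen_submodule R M A <+>\<^bsub>M\<^esub> K"
      using split sB submodule_subset_sum(1)[OF N K] by blast
    then obtain u v where u: "u \<in> gen_submodule R M A" and v: "v \<in> K"
      and suv: "s \<odot>\<^bsub>M\<^esub> x = u \<oplus>\<^bsub>M\<^esub> v"
      by (rule set_add_memE)
    have uN: "u \<in> N"
      using u gen_submodule_least[OF N AN] by blast
    have vM: "v \<in> carrier M"
      using v KM by blast
    have "v \<in> N"
      using submodule_add_cancel[OF N uN _ vM] submodule_smult[OF N sR x] suv by simp
    then have "t \<odot>\<^bsub>M\<^esub> v \<in> gen_submodule R M Q"
      using v P(2) tQ by blast
    then have "t \<odot>\<^bsub>M\<^esub> v \<in> gen_submodule R M (A \<union> Q)"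
      using gen_submodule_mono[of Q "A \<union> Q"] by blast
    moreover have "t \<odot>\<^bsub>M\<^esub> u \<in> gen_submodule R M (A \<union> Q)"
      using gen_submodule_mono[of A "A \<union> Q"] u submodule_smult[OF gAQ tR] by blast
    moreover have "(t \<otimes> s) \<odot>\<^bsub>M\<^esub> x = t \<odot>\<^bsub>M\<^esub> u \<oplus>\<^bsub>M\<^esub> t \<odot>\<^bsub>M\<^esub> v"
      using x uN NM vM sR tR suv by (simp add: smult_assoc1 smult_r_distr subset_iff)
    ultimately show "(t \<otimes> s) \<odot>\<^bsub>M\<^esub> x \<in> gen_submodule R M (A \<union> Q)"
      using submodule_add[OF gAQ] by simp
  qed (use s t finA Q AN P(3) in auto)
qed

text \<open>
  The finite set witnessing \<open>S\<close>-finiteness of the union of a chain already lies in a single member,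
  which is then \<open>S\<close>-finite with the same witnesses.  So the submodules that are not \<open>S\<close>-finite are
  closed under unions of chains.
\<close>

lemma exists_maximal_not_S_fin:
  assumes "submodule N\<^sub>0 R M" "\<not> S_fin N\<^sub>0"
  obtains N where "submodule N R M" "\<not> S_fin N"
    "\<And>L. \<lbrakk>submodule L R M; N \<subset> L\<rbrakk> \<Longrightarrow> S_fin L"
proof -
  let ?\<A> = "{N. submodule N R M \<and> \<not> S_fin N}"
  have "\<exists>N\<in>?\<A>. \<forall>X\<in>?\<A>. N \<subseteq> X \<longrightarrow> X = N"
  proof (rule subset_Zorn_nonempty)
    show "?\<A> \<noteq> {}" using assms by blast
  next
    fix \<C> assume ne: "\<C> \<noteq> {}" and chain: "subset.chain ?\<A> \<C>"
    have "\<not> S_fin (\<Union>\<C>)"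
    proof
      assume "S_fin (\<Union>\<C>)"
      then obtain s A where s: "s \<in> S" and A: "finite A" "A \<subseteq> \<Union>\<C>"
        and sA: "\<And>x. x \<in> \<Union>\<C> \<Longrightarrow> s \<odot>\<^bsub>M\<^esub> x \<in> gen_submodule R M A"
        by (rule S_finE) blast
      obtain X where X: "X \<in> \<C>" "A \<subseteq> X"
        using finite_subset_Union_chain[OF A ne chain] .
      then have "S_fin X"
        using s A sA by (intro S_finI[of s A]) auto
      then show False
        using X chain unfolding subset_chain_def by blast
    qed
    moreover have "subset.chain {N. submodule N R M} \<C>"
      using chain unfolding subset_chain_def by blast
    ultimately show "\<Union>\<C> \<in> ?\<A>"
      using submodule_Union_chain[OF ne] by blast
  qed
  then show thesis
    using that by blast
qed

end


section \<open>Submodules maximal among those that are not \<open>S\<close>-finite\<close>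

locale maximal_not_S_fin = module_with_multset +
  fixes N
  assumes submod: "submodule N R M"
    and not_S_fin: "\<not> S_fin N"
    and maximal: "\<And>L. \<lbrakk>submodule L R M; N \<subset> L\<rbrakk> \<Longrightarrow> S_fin L"
begin

lemma S_fin_sum_of_not_subset:
  assumes "submodule K R M" "\<not> K \<subseteq> N"
  shows "S_fin (N <+>\<^bsub>M\<^esub> K)"
  using assms submodule_subset_sum[OF submod assms(1)]
  by (intro maximal submodule_sum submod) auto

text \<open>
  If both alternatives failed, \<open>N + aM\<close> and \<open>(N : a)\<close> would strictly contain \<open>N\<close> and thus be
  \<open>S\<close>-finite; so would \<open>a(N : a) = N \<inter> aM\<close>, and then \<open>N\<close> itself.
\<close>

lemma smult_into_or_cancel:
  assumes a: "a \<in> carrier R"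
  shows "(\<forall>x\<in>carrier M. a \<odot>\<^bsub>M\<^esub> x \<in> N) \<or> (\<forall>x\<in>carrier M. a \<odot>\<^bsub>M\<^esub> x \<in> N \<longrightarrow> x \<in> N)"
proof (rule ccontr)
  assume "\<not> ?thesis"
  then obtain y z where y: "y \<in> carrier M" "a \<odot>\<^bsub>M\<^esub> y \<notin> N"
    and z: "z \<in> carrier M" "a \<odot>\<^bsub>M\<^esub> z \<in> N" "z \<notin> N"
    by blast
  let ?aM = "(\<lambda>x. a \<odot>\<^bsub>M\<^esub> x) ` carrier M"
  let ?res = "{x \<in> carrier M. a \<odot>\<^bsub>M\<^esub> x \<in> N}"
  have aM: "submodule ?aM R M"
    by (rule submodule_smult_image[OF carrier_is_submodule a])
  have "N \<subset> ?res"
    using z submodule_subset[OF submod] submodule_smult[OF submod a] by blast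
  then have "S_fin ?res"
    by (rule maximal[OF submodule_residual[OF submod a]])
  then have "S_fin ((\<lambda>x. a \<odot>\<^bsub>M\<^esub> x) ` ?res)"
    using a by (intro S_fin_smult_image) auto
  moreover have "S_fin (N <+>\<^bsub>M\<^esub> ?aM)"
    using y by (intro S_fin_sum_of_not_subset aM) auto
  ultimately have "S_fin N"
    by (intro S_fin_of_sum_and_inter[OF submod aM]) auto
  then show False
    using not_S_fin by blast
qed

definition colon :: "'a set" where
  "colon = {r \<in> carrier R. \<forall>x\<in>carrier M. r \<odot>\<^bsub>M\<^esub> x \<in> N}"

lemma cancel_outside_colon:
  "\<lbrakk>r \<in> carrier R; r \<notin> colon; x \<in> carrier M; r \<odot>\<^bsub>M\<^esub> x \<in> N\<rbrakk> \<Longrightarrow> x \<in> N"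
  using smult_into_or_cancel unfolding colon_def by blast

lemma Ann_subset_colon: "Ann R M \<subseteq> colon"
  using submodule_zero[OF submod] unfolding Ann_def colon_def by auto

lemma ideal_colon: "ideal colon R"
proof (rule idealI)
  show "subgroup colon (add_monoid R)"
  proof (rule R.add.subgroupI)
    show "colon \<subseteq> carrier R"
      unfolding colon_def by blast
    have "\<zero> \<in> colon"
      using submodule_zero[OF submod] by (simp add: colon_def)
    then show "colon \<noteq> {}" by blast
    show "\<ominus> a \<in> colon" if "a \<in> colon" for a
      using that submoduleE(3)[OF submod] by (simp add: colon_def smult_l_minus)
    show "a \<oplus> b \<in> colon" if "a \<in> colon" "b \<in> colon" for a b
      using that submodule_add[OF submod] by (simp add: colon_def smult_l_distr)
  qed
  have "x \<otimes> a \<in> colon" if "a \<in> colon" "x \<in> carrier R" for a x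
    using that submodule_smult[OF submod] by (simp add: colon_def smult_assoc1)
  then show "x \<otimes> a \<in> colon" "a \<otimes> x \<in> colon" if "a \<in> colon" "x \<in> carrier R" for a x
    using that R.m_comm[of a x] by (auto simp: colon_def)
qed (rule R.ring_axioms)

lemma primeideal_colon:
  assumes proper: "N \<noteq> carrier M"
  shows "primeideal colon R"
proof (rule primeidealI[OF ideal_colon R.is_cring])
  have "\<one> \<notin> colon"
    using proper submodule_subset[OF submod] unfolding colon_def by auto
  then show "carrier R \<noteq> colon" by auto
next
  fix a b assume ab: "a \<in> carrier R" "b \<in> carrier R" "a \<otimes> b \<in> colon"
  show "a \<in> colon \<or> b \<in> colon"
  proof (cases "a \<in> colon")
    case False
    then have "b \<odot>\<^bsub>M\<^esub> x \<in> N" if "x \<in> carrier M" for x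
      using that ab cancel_outside_colon[of a "b \<odot>\<^bsub>M\<^esub> x"]
      by (simp add: colon_def smult_assoc1)
    then show ?thesis
      using ab by (simp add: colon_def)
  qed simp
qed

lemma prime_saturation_colon_subset: "prime_saturation R M colon \<subseteq> N"
proof -
  have "ideal_smult R colon M \<subseteq> N"
    unfolding ideal_smult_def
    by (rule gen_submodule_least[OF submod]) (auto simp: colon_def)
  then show ?thesis
    unfolding prime_saturation_def using cancel_outside_colon by blast
qed

text \<open>
  For \<open>x \<in> M - N\<close> the conductor \<open>{r. rx \<in> N}\<close> is contained in \<open>(N : M)\<close>, so \<open>N \<inter> Rx\<close> lies in
  \<open>(N : M)M\<close>.  If an \<open>S\<close>-finite \<open>P\<close> lay between that module and \<open>M(\<pp>) \<subseteq> N\<close>, where \<open>\<pp> = (N : M)\<close>,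
  it would also lie between \<open>N \<inter> Rx\<close> and \<open>N\<close> and make \<open>N\<close> itself \<open>S\<close>-finite.
\<close>

lemma no_S_fin_above_colon_smult:
  assumes proper: "N \<noteq> carrier M"
    and P: "S_fin P" "ideal_smult R colon M \<subseteq> P"
  shows "\<not> P \<subseteq> prime_saturation R M colon"
proof
  assume "P \<subseteq> prime_saturation R M colon"
  then have PN: "P \<subseteq> N"
    using prime_saturation_colon_subset by blast
  obtain x where x: "x \<in> carrier M" "x \<notin> N"
    using proper submodule_subset[OF submod] by blast
  let ?Rx = "(\<lambda>r. r \<odot>\<^bsub>M\<^esub> x) ` carrier R"
  have Rx: "submodule ?Rx R M"
    by (rule submodule_cyclic[OF x(1)])
  have "x \<in> ?Rx"
    using x(1) smult_one by (metis imageI R.one_closed)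
  then have "S_fin (N <+>\<^bsub>M\<^esub> ?Rx)"
    using x by (intro S_fin_sum_of_not_subset Rx) auto
  moreover have "N \<inter> ?Rx \<subseteq> P"
  proof
    fix y assume "y \<in> N \<inter> ?Rx"
    then obtain r where r: "r \<in> carrier R" "y = r \<odot>\<^bsub>M\<^esub> x" "r \<odot>\<^bsub>M\<^esub> x \<in> N"
      by blast
    then have "r \<in> colon"
      using x cancel_outside_colon by blast
    then show "y \<in> P"
      using r x P(2) smult_mem_ideal_smult by blast
  qed
  ultimately have "S_fin N"
    by (rule S_fin_of_sum_and_inter[OF submod Rx _ P(1) _ PN])
  then show False
    using not_S_fin by blast
qed

end


section \<open>The Cohen-type criterion\<close>

theorem theorem2p1:
  fixes R :: "('a, 'r) ring_scheme"
    and M :: "('a, 'b, 'm) module_scheme"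
    and S :: "'a set"
  assumes "cring R"
    and "submonoid S R"
    and "module R M"
    and "S_finite R S M"
  shows "S_noetherian R S M \<longleftrightarrow>
    (\<forall>\<pp>. primeideal \<pp> R \<and> Ann R M \<subseteq> \<pp> \<longrightarrow>
      (\<exists>N. submodule N R M \<and> S_finite R S (M\<lparr>carrier := N\<rparr>) \<and>
        ideal_smult R \<pp> M \<subseteq> N \<and> N \<subseteq> prime_saturation R M \<pp>))"
    (is "_ \<longleftrightarrow> ?cohen")
proof -
  interpret module_with_multset R M S
    using assms by (intro module_with_multset.intro)
  show ?thesis
  proof
    assume noeth: "S_noetherian R S M"
    show ?cohen
    proof (intro allI impI)
      fix \<pp> assume "primeideal \<pp> R \<and> Ann R M \<subseteq> \<pp>"
      then have p: "primeideal \<pp> R" ..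
      then have "\<pp> \<subseteq> carrier R"
        using ideal.axioms(1)[OF primeideal.axioms(1)] additive_subgroup.a_subset by blast
      then have "submodule (ideal_smult R \<pp> M) R M"
        by (rule submodule_ideal_smult)
      then show "\<exists>N. submodule N R M \<and> S_finite R S (M\<lparr>carrier := N\<rparr>) \<and>
          ideal_smult R \<pp> M \<subseteq> N \<and> N \<subseteq> prime_saturation R M \<pp>"
        using noeth ideal_smult_subset_prime_saturation[OF p]
        unfolding S_noetherian_def by blast
    qed
  next
    assume cohen: ?cohen
    show "S_noetherian R S M"
    proof (rule ccontr)
      assume "\<not> S_noetherian R S M"
      then obtain N\<^sub>0 where "submodule N\<^sub>0 R M" "\<not> S_fin N\<^sub>0"
        unfolding S_noetherian_iff by blast
      then obtain N where N: "submodule N R M" "\<not> S_fin N"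
        "\<And>L. \<lbrakk>submodule L R M; N \<subset> L\<rbrakk> \<Longrightarrow> S_fin L"
        by (rule exists_maximal_not_S_fin) blast
      interpret maximal_not_S_fin R M S N
        by (intro maximal_not_S_fin.intro maximal_not_S_fin_axioms.intro
            module_with_multset_axioms) (fact N)+
      have proper: "N \<noteq> carrier M"
        using assms(4) N(2) S_finite_iff by blast
      obtain P where "submodule P R M" "S_finite R S (M\<lparr>carrier := P\<rparr>)"
        "ideal_smult R colon M \<subseteq> P" "P \<subseteq> prime_saturation R M colon"
        using cohen primeideal_colon[OF proper] Ann_subset_colon by blast
      then show False
        using no_S_fin_above_colon_smult[OF proper] S_finite_restrict_iff by blast
    qed
  qed
qed

end
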